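(* Let $D$ be the derivation on $\mathbb{Q}[a,b,x,y,z]$ determined by $$D(a)=az,\quad D(b)=xy,\quad D(x)=xy,\quad D(y)=xy,\quad D(z)=xy$$ (extended by linearity and the Leibniz rule). For $n\ge 1$ let $$R_n(x,y,z)=\sum_{\sigma\in S_n} x^{\mathrm{jump}(\sigma)} y^{\mathrm{des}(\sigma)} z^{\mathrm{suc}(\sigma)}.$$ Then for every $n\ge 1$, $$R_n(x,y,z)=D^{n-1}(ab)\big|_{a=1,\,b=1}.$$
   Context: $S_n$ is the set of permutations $\sigma=\sigma_1\cdots\sigma_n$ of $[n]$, with $\sigma_0=0$. $\mathrm{jump}(\sigma)$ is the number of indices $1\le i\le n$ with $\sigma_i\ge\sigma_{i-1}+2$; $\mathrm{des}(\sigma)$ is the number of indices $1\le i\le n-1$ with $\sigma_i>\sigma_{i+1}$; $\mathrm{suc}(\sigma)$ is the number of indices $1\le i\le n-1$ with $\sigma_i+1=\sigma_{i+1}$ (interior successions). *)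

theory Defs
  imports Complex_Main "HOL-Library.Poly_Mapping" "HOL-Combinatorics.Permutations"
begin

datatype indet = Ind_a | Ind_b | Ind_x | Ind_y | Ind_z

lemma UNIV_indet: "(UNIV :: indet set) = {Ind_a, Ind_b, Ind_x, Ind_y, Ind_z}"
  using indet.exhaust by auto

instance indet :: finite
  by standard (simp add: UNIV_indet)

(* The polynomial ring Q[a,b,x,y,z] as the monoid algebra over Q of the free commutative
   monoid on the indeterminates: a monomial is its exponent function. *)
type_synonym mpol = "(indet \<Rightarrow>\<^sub>0 nat) \<Rightarrow>\<^sub>0 rat"

definition mpol_const :: "rat \<Rightarrow> mpol" where
  "mpol_const c = Poly_Mapping.single 0 c"

definition mpol_var :: "indet \<Rightarrow> mpol" where
  "mpol_var v = Poly_Mapping.single (Poly_Mapping.single v 1) 1"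

abbreviation var_a :: mpol where "var_a \<equiv> mpol_var Ind_a"
abbreviation var_b :: mpol where "var_b \<equiv> mpol_var Ind_b"
abbreviation var_x :: mpol where "var_x \<equiv> mpol_var Ind_x"
abbreviation var_y :: mpol where "var_y \<equiv> mpol_var Ind_y"
abbreviation var_z :: mpol where "var_z \<equiv> mpol_var Ind_z"

definition mpol_subst :: "(indet \<Rightarrow> mpol) \<Rightarrow> mpol \<Rightarrow> mpol" where
  "mpol_subst s p =
     (\<Sum>m\<in>Poly_Mapping.keys p.
        mpol_const (Poly_Mapping.lookup p m) * (\<Prod>v\<in>UNIV. s v ^ Poly_Mapping.lookup m v))"

(* p |_{a=1, b=1}, again as an element of Q[a,b,x,y,z] *)
definition at_a1_b1 :: "mpol \<Rightarrow> mpol" where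
  "at_a1_b1 = mpol_subst (mpol_var(Ind_a := 1, Ind_b := 1))"

definition is_derivation :: "(mpol \<Rightarrow> mpol) \<Rightarrow> bool" where
  "is_derivation D \<longleftrightarrow>
     (\<forall>p q. D (p + q) = D p + D q) \<and>
     (\<forall>c p. D (mpol_const c * p) = mpol_const c * D p) \<and>
     (\<forall>p q. D (p * q) = D p * q + p * D q)"

(* A permutation of [n] is a function s with s permutes {1..n}; such an s fixes 0, which is
   the convention s_0 = 0 that jump relies on at i = 1. *)
definition jump :: "nat \<Rightarrow> (nat \<Rightarrow> nat) \<Rightarrow> nat" where
  "jump n s = card {i. 1 \<le> i \<and> i \<le> n \<and> s i \<ge> s (i - 1) + 2}"

definition des :: "nat \<Rightarrow> (nat \<Rightarrow> nat) \<Rightarrow> nat" where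
  "des n s = card {i. 1 \<le> i \<and> i \<le> n - 1 \<and> s i > s (i + 1)}"

definition suc :: "nat \<Rightarrow> (nat \<Rightarrow> nat) \<Rightarrow> nat" where
  "suc n s = card {i. 1 \<le> i \<and> i \<le> n - 1 \<and> s i + 1 = s (i + 1)}"

definition R :: "nat \<Rightarrow> mpol" where
  "R n = (\<Sum>s | s permutes {1..n}. var_x ^ jump n s * var_y ^ des n s * var_z ^ suc n s)"

(* The remaining facts show that a derivation of Q[a,b,x,y,z] with prescribed values on the
   indeterminates exists and is unique. *)

lemma mpol_induct [case_names single add]:
  fixes p :: mpol
  assumes single: "\<And>m c. P (Poly_Mapping.single m c)"
    and add: "\<And>p q. P p \<Longrightarrow> P q \<Longrightarrow> P (p + q)"
  shows "P p"
proof (induction p rule: Poly_Mapping.update_induct)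
  case const
  show ?case using single[of 0 0] by simp
next
  case (update f m c)
  have "Poly_Mapping.update m c f = Poly_Mapping.single m c + f"
    using update(1)
    by (intro poly_mapping_eqI)
      (auto simp: lookup_update lookup_add lookup_single when_def in_keys_iff)
  then show ?case using add[OF single update(3)] by simp
qed

lemma exponent_induct [case_names zero step]:
  fixes m :: "indet \<Rightarrow>\<^sub>0 nat"
  assumes zero: "P 0" and step: "\<And>v m. P m \<Longrightarrow> P (Poly_Mapping.single v 1 + m)"
  shows "P m"
proof -
  have mult: "P (Poly_Mapping.single v k + m)" if "P m" for v k m
  proof (induction k)
    case (Suc k)
    have "Poly_Mapping.single v (Suc k) + m
        = Poly_Mapping.single v 1 + (Poly_Mapping.single v k + m)"
      using single_add[of v 1 k] by (simp add: add.assoc)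
    then show ?case using step[OF Suc.IH] by simp
  qed (simp add: that)
  show ?thesis
  proof (induction m rule: Poly_Mapping.update_induct)
    case (update f v k)
    have "Poly_Mapping.update v k f = Poly_Mapping.single v k + f"
      using update(1)
      by (intro poly_mapping_eqI)
        (auto simp: lookup_update lookup_add lookup_single when_def in_keys_iff)
    then show ?case using mult[OF update(3)] by simp
  qed (rule zero)
qed

lemma ex1_derivation:
  fixes g :: "indet \<Rightarrow> mpol"
  shows "\<exists>!D. is_derivation D \<and> (\<forall>v. D (mpol_var v) = g v)"
proof (rule ex_ex1I)
  define d where "d m = (\<Sum>v\<in>UNIV. Poly_Mapping.single (m - Poly_Mapping.single v 1)
      (rat_of_nat (Poly_Mapping.lookup m v)) * g v)" for m
  define D where
    "D p = (\<Sum>m\<in>Poly_Mapping.keys p. mpol_const (Poly_Mapping.lookup p m) * d m)"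
    for p :: mpol
  have D_add: "D (p + q) = D p + D q" for p q
    unfolding D_def
    by (rule setsum_keys_plus_distrib[where f = "\<lambda>m c. mpol_const c * d m"])
      (simp_all add: mpol_const_def single_add distrib_right)
  have D_single: "D (Poly_Mapping.single m c) = mpol_const c * d m" for m c
    by (cases "c = 0") (simp_all add: D_def mpol_const_def)
  have shift: "Poly_Mapping.single (m + m' - Poly_Mapping.single v 1)
        (rat_of_nat (Poly_Mapping.lookup m v))
      = Poly_Mapping.single (m - Poly_Mapping.single v 1) (rat_of_nat (Poly_Mapping.lookup m v))
          * Poly_Mapping.single m' 1" for m m' :: "indet \<Rightarrow>\<^sub>0 nat" and v
  proof (cases "Poly_Mapping.lookup m v = 0")
    case False
    have "m + m' - Poly_Mapping.single v 1 = m - Poly_Mapping.single v 1 + m'"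
      using False by (intro poly_mapping_eqI)
        (auto simp: lookup_minus lookup_add lookup_single when_def)
    then show ?thesis by (simp add: mult_single)
  qed simp
  have d_add: "d (m + m') = d m * Poly_Mapping.single m' 1 + Poly_Mapping.single m 1 * d m'"
    for m m'
  proof -
    have "d (m + m') = (\<Sum>v\<in>UNIV.
        (Poly_Mapping.single (m + m' - Poly_Mapping.single v 1)
            (rat_of_nat (Poly_Mapping.lookup m v))
          + Poly_Mapping.single (m' + m - Poly_Mapping.single v 1)
              (rat_of_nat (Poly_Mapping.lookup m' v))) * g v)"
      unfolding d_def by (simp only: lookup_add of_nat_add single_add add.commute[of m'])
    also have "\<dots> = d m * Poly_Mapping.single m' 1 + Poly_Mapping.single m 1 * d m'"
      unfolding d_def shift
      by (simp add: sum.distrib sum_distrib_left sum_distrib_right algebra_simps)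
    finally show ?thesis .
  qed
  have D_mult_single: "D (Poly_Mapping.single m c * Poly_Mapping.single m' c')
      = D (Poly_Mapping.single m c) * Poly_Mapping.single m' c'
        + Poly_Mapping.single m c * D (Poly_Mapping.single m' c')" for m c m' c'
  proof -
    have s: "Poly_Mapping.single k e = mpol_const e * Poly_Mapping.single k 1" for k e
      by (simp add: mpol_const_def mult_single)
    have "D (Poly_Mapping.single m c * Poly_Mapping.single m' c')
        = mpol_const (c * c') * d (m + m')"
      by (simp add: mult_single D_single)
    also have "mpol_const (c * c') = mpol_const c * mpol_const c'"
      by (simp add: mpol_const_def mult_single)
    also have "mpol_const c * mpol_const c' * d (m + m')
        = (mpol_const c * d m) * (mpol_const c' * Poly_Mapping.single m' 1)
          + (mpol_const c * Poly_Mapping.single m 1) * (mpol_const c' * d m')"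
      by (simp add: d_add algebra_simps)
    finally show ?thesis
      by (simp only: D_single s[symmetric])
  qed
  have D_mult_left: "D (Poly_Mapping.single m c * q)
      = D (Poly_Mapping.single m c) * q + Poly_Mapping.single m c * D q" for m c q
    by (induction q rule: mpol_induct)
      (simp_all add: D_mult_single D_add distrib_left distrib_right add_ac)
  have D_mult: "D (p * q) = D p * q + p * D q" for p q
    by (induction p rule: mpol_induct)
      (simp_all add: D_mult_left D_add distrib_left distrib_right add_ac)
  have d0: "d 0 = 0"
    by (simp add: d_def)
  have D_const: "D (mpol_const c) = 0" for c
    using D_single[of 0 c] by (simp add: d0 mpol_const_def)
  have "D (mpol_var v) = g v" for v
  proof -
    have "D (mpol_var v) = d (Poly_Mapping.single v 1)"
      by (simp add: mpol_var_def D_single) (simp add: mpol_const_def)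
    also have "\<dots> = (\<Sum>w\<in>UNIV. if w = v then g v else 0)"
      unfolding d_def by (intro sum.cong) (auto simp: lookup_single when_def)
    also have "\<dots> = g v" by simp
    finally show ?thesis .
  qed
  then show "\<exists>D. is_derivation D \<and> (\<forall>v. D (mpol_var v) = g v)"
    by (intro exI[of _ D]) (simp add: is_derivation_def D_add D_mult D_const)
next
  fix D E
  assume D: "is_derivation D \<and> (\<forall>v. D (mpol_var v) = g v)"
    and E: "is_derivation E \<and> (\<forall>v. E (mpol_var v) = g v)"
  have one: "F 1 = 0" if "is_derivation F" for F
  proof -
    have "F (1 * 1) = F 1 * 1 + 1 * F 1"
      using that unfolding is_derivation_def by blast
    then show ?thesis by simp
  qed
  have mono: "D (Poly_Mapping.single m 1) = E (Poly_Mapping.single m 1)" for m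
  proof (induction m rule: exponent_induct)
    case zero
    show ?case using one[of D] one[of E] D E by simp
  next
    case (step v m)
    have "Poly_Mapping.single (Poly_Mapping.single v 1 + m) 1
        = mpol_var v * Poly_Mapping.single m 1"
      by (simp add: mpol_var_def mult_single)
    then show ?case using D E step unfolding is_derivation_def by simp
  qed
  show "D = E"
  proof
    fix p
    show "D p = E p"
    proof (induction p rule: mpol_induct)
      case (single m c)
      have "Poly_Mapping.single m c = mpol_const c * Poly_Mapping.single m 1"
        by (simp add: mpol_const_def mult_single)
      then show ?case using D E mono unfolding is_derivation_def by metis
    next
      case (add p q)
      then show ?case using D E unfolding is_derivation_def by simp
    qed
  qed
qed

end

(* A permutation s of [n] has n + 1 gaps: one after each s_k with 0 \<le> k \<le> n, the last of which is
   closed up by the letter 0. The gap after the letter n is labelled a. Every other gap is labelled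
   y at a descent, x at a jump, z at an interior succession, and b if it is the gap between s_0 = 0
   and s_1 = 1. Inserting n + 1 into a gap acts on the product of the labels as D acts on the factor
   coming from that gap: after n, a becomes z a; elsewhere the gap is replaced by a jump x
   followed by the new gap a, while the old a turns into y. So D maps the sum of these products over
   S_n to the one over S_(n+1). *)

theory Submission
  imports Defs
begin

section \<open>Substitution is a ring homomorphism\<close>

lemma mpol_const_mult: "mpol_const (c * d) = mpol_const c * mpol_const d"
  by (simp add: mpol_const_def mult_single)

lemma mpol_subst_single:
  "mpol_subst s (Poly_Mapping.single m c) =
     mpol_const c * (\<Prod>v\<in>UNIV. s v ^ Poly_Mapping.lookup m v)"
  by (cases "c = 0") (simp_all add: mpol_subst_def mpol_const_def)

lemma mpol_subst_add: "mpol_subst s (p + q) = mpol_subst s p + mpol_subst s q"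
  unfolding mpol_subst_def
  by (rule setsum_keys_plus_distrib[where
        f = "\<lambda>m c. mpol_const c * (\<Prod>v\<in>UNIV. s v ^ Poly_Mapping.lookup m v)"])
    (simp_all add: mpol_const_def single_add distrib_right)

text \<open>Both sides are additive in each factor, which reduces the claim to monomials, where
  exponents add.\<close>

lemma mpol_subst_mult: "mpol_subst s (p * q) = mpol_subst s p * mpol_subst s q"
proof -
  have single: "mpol_subst s (Poly_Mapping.single m c * Poly_Mapping.single m' c')
      = mpol_subst s (Poly_Mapping.single m c) * mpol_subst s (Poly_Mapping.single m' c')"
    for m c m' c'
    by (simp add: mult_single mpol_subst_single mpol_const_mult lookup_add power_add
        prod.distrib mult_ac)
  have left: "mpol_subst s (Poly_Mapping.single m c * q)
      = mpol_subst s (Poly_Mapping.single m c) * mpol_subst s q" for m c q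
    by (induction q rule: mpol_induct) (simp_all add: single mpol_subst_add distrib_left)
  show ?thesis
    by (induction p rule: mpol_induct) (simp_all add: left mpol_subst_add distrib_right)
qed

lemma mpol_subst_0: "mpol_subst s 0 = 0"
  by (simp add: mpol_subst_def)

lemma mpol_subst_1: "mpol_subst s 1 = 1"
  using mpol_subst_single[of s 0 1] by (simp add: mpol_const_def)

lemma mpol_subst_var: "mpol_subst s (mpol_var v) = s v"
proof -
  have "mpol_subst s (mpol_var v)
      = (\<Prod>w\<in>UNIV. s w ^ Poly_Mapping.lookup (Poly_Mapping.single v 1) w)"
    unfolding mpol_var_def mpol_subst_single by (simp add: mpol_const_def)
  also have "\<dots> = (\<Prod>w\<in>UNIV. if w = v then s v else 1)"
    by (intro prod.cong) (auto simp: lookup_single when_def)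
  finally show ?thesis by simp
qed

lemma mpol_subst_sum: "mpol_subst s (sum f A) = (\<Sum>i\<in>A. mpol_subst s (f i))"
  by (induction A rule: infinite_finite_induct) (simp_all add: mpol_subst_0 mpol_subst_add)

lemma mpol_subst_prod: "mpol_subst s (prod f A) = (\<Prod>i\<in>A. mpol_subst s (f i))"
  by (induction A rule: infinite_finite_induct) (simp_all add: mpol_subst_1 mpol_subst_mult)

section \<open>Derivations of finite sums and products\<close>

lemma derivation_0:
  assumes "is_derivation D"
  shows "D 0 = 0"
proof -
  have "D (0 + 0) = D 0 + D 0"
    using assms unfolding is_derivation_def by blast
  then show ?thesis by simp
qed

lemma derivation_1:
  assumes "is_derivation D"
  shows "D 1 = 0"
proof -
  have "D (1 * 1) = D 1 * 1 + 1 * D 1"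
    using assms unfolding is_derivation_def by blast
  then show ?thesis by simp
qed

lemma derivation_sum:
  assumes "is_derivation D"
  shows "D (sum f A) = (\<Sum>i\<in>A. D (f i))"
proof -
  have "D (p + q) = D p + D q" for p q
    using assms unfolding is_derivation_def by blast
  then show ?thesis
    by (induction A rule: infinite_finite_induct) (simp_all add: derivation_0[OF assms])
qed

lemma derivation_prod:
  assumes D: "is_derivation D" and "finite A"
  shows "D (prod f A) = (\<Sum>i\<in>A. D (f i) * prod f (A - {i}))"
  using \<open>finite A\<close>
proof (induction A)
  case empty
  show ?case by (simp add: derivation_1[OF D])
next
  case (insert j A)
  have "D (prod f (insert j A)) = D (f j) * prod f A + f j * D (prod f A)"
    using D insert.hyps by (simp add: is_derivation_def)
  also have "f j * D (prod f A) = (\<Sum>i\<in>A. D (f i) * prod f (insert j A - {i}))"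
    unfolding insert.IH sum_distrib_left
  proof (intro sum.cong refl)
    fix i assume "i \<in> A"
    then have "insert j A - {i} = insert j (A - {i})"
      using insert.hyps by auto
    then show "f j * (D (f i) * prod f (A - {i})) = D (f i) * prod f (insert j A - {i})"
      using insert.hyps by (simp add: mult_ac)
  qed
  finally show ?case using insert.hyps by simp
qed

section \<open>Inserting the largest letter\<close>

(* Composition on the right with this cycle moves the letter in place n + 1 to place i + 1. *)
definition insertion_cycle :: "nat \<Rightarrow> nat \<Rightarrow> nat \<Rightarrow> nat" where
  "insertion_cycle n i k =
     (if k \<le> i then k else if k = Suc i then Suc n else if k \<le> Suc n then k - 1 else k)"

lemma insertion_cycle_permutes:
  assumes "i \<le> n"
  shows "insertion_cycle n i permutes {1..Suc n}"
proof (rule bij_imp_permutes)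
  have "inj_on (insertion_cycle n i) {1..Suc n}"
    using assms by (auto simp: inj_on_def insertion_cycle_def split: if_splits)
  moreover have "insertion_cycle n i ` {1..Suc n} \<subseteq> {1..Suc n}"
    using assms by (auto simp: insertion_cycle_def)
  ultimately show "bij_betw (insertion_cycle n i) {1..Suc n} {1..Suc n}"
    by (simp add: bij_betw_def endo_inj_surj)
  show "insertion_cycle n i k = k" if "k \<notin> {1..Suc n}" for k
    using that assms by (auto simp: insertion_cycle_def)
qed

text \<open>Since \<open>s\<close> fixes \<open>Suc n\<close>, the composite takes the value
  \<open>Suc n\<close> exactly at place \<open>Suc i\<close>. The place of the largest letter thus
  determines \<open>i\<close>, and cancelling the cycle then recovers \<open>s\<close>.\<close>

lemma bij_betw_insertion:
  "bij_betw (\<lambda>(s, i). s \<circ> insertion_cycle n i)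
     ({s. s permutes {1..n}} \<times> {..n}) {s. s permutes {1..Suc n}}"
proof (rule bij_betwI')
  fix p q
  assume p: "p \<in> {s. s permutes {1..n}} \<times> {..n}" and q: "q \<in> {s. s permutes {1..n}} \<times> {..n}"
  obtain s i t j where pq: "p = (s, i)" "q = (t, j)" by fastforce
  have s: "s permutes {1..n}" and t: "t permutes {1..n}" and ij: "i \<le> n" "j \<le> n"
    using p q by (auto simp: pq)
  have "s = t \<and> i = j" if eq: "s \<circ> insertion_cycle n i = t \<circ> insertion_cycle n j"
  proof -
    have pos: "insertion_cycle n j k = Suc n \<Longrightarrow> k = Suc j" for k
      using ij by (auto simp: insertion_cycle_def split: if_splits)
    have top: "s (Suc n) = Suc n" "t (Suc n) = Suc n"
      using s t by (auto intro: permutes_not_in)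
    have "t (insertion_cycle n j (Suc i)) = s (insertion_cycle n i (Suc i))"
      using fun_cong[OF eq, of "Suc i"] by simp
    also have "\<dots> = t (Suc n)"
      using top by (simp add: insertion_cycle_def)
    finally have "insertion_cycle n j (Suc i) = Suc n"
      using permutes_inj[OF t] by (simp add: inj_eq)
    then have "i = j" using pos by blast
    moreover have "surj (insertion_cycle n i)"
      using permutes_surj[OF insertion_cycle_permutes[OF ij(1)]] .
    ultimately show ?thesis
      using eq by (metis surj_fun_eq)
  qed
  then show "((case p of (s, i) \<Rightarrow> s \<circ> insertion_cycle n i) =
      (case q of (s, i) \<Rightarrow> s \<circ> insertion_cycle n i)) = (p = q)"
    by (auto simp: pq)
next
  fix p assume "p \<in> {s. s permutes {1..n}} \<times> {..n}"
  then obtain s i where p: "p = (s, i)" "s permutes {1..n}" "i \<le> n" by auto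
  have "s permutes {1..Suc n}" using p(2) by (rule permutes_subset) auto
  then show "(case p of (s, i) \<Rightarrow> s \<circ> insertion_cycle n i) \<in> {s. s permutes {1..Suc n}}"
    using permutes_compose[OF insertion_cycle_permutes[OF p(3)]] p by simp
next
  fix t assume "t \<in> {s. s permutes {1..Suc n}}"
  then have t: "t permutes {1..Suc n}" by simp
  obtain k where k: "t k = Suc n" using permutes_surj[OF t] by (metis surjD)
  then have "k \<in> {1..Suc n}" using permutes_in_image[OF t, of k] by simp
  then obtain i where i: "k = Suc i" "i \<le> n" by (cases k) auto
  define c where "c = insertion_cycle n i"
  have c: "c permutes {1..Suc n}" unfolding c_def by (rule insertion_cycle_permutes[OF i(2)])
  define s where "s = t \<circ> inv c"
  have s: "s permutes {1..Suc n}" unfolding s_def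
    by (rule permutes_compose[OF permutes_inv[OF c] t])
  have "c (Suc i) = Suc n" by (simp add: c_def insertion_cycle_def)
  then have "inv c (Suc n) = Suc i" using permutes_inverses(2)[OF c] by metis
  then have "s (Suc n) = Suc n" using k i by (simp add: s_def)
  then have "s permutes {1..n}"
    using s by (intro permutes_superset[OF s]) (auto simp: le_Suc_eq)
  moreover have "t = s \<circ> c"
    using permutes_inv_o(2)[OF c] by (simp add: s_def o_assoc[symmetric])
  ultimately show "\<exists>p\<in>{s. s permutes {1..n}} \<times> {..n}.
      t = (case p of (s, i) \<Rightarrow> s \<circ> insertion_cycle n i)"
    using i by (intro bexI[of _ "(s, i)"]) (auto simp: c_def)
qed

section \<open>Labelled gaps\<close>

definition next_letter :: "nat \<Rightarrow> (nat \<Rightarrow> nat) \<Rightarrow> nat \<Rightarrow> nat" where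
  "next_letter n s k = (if k = n then 0 else s (Suc k))"

definition step_label :: "nat \<Rightarrow> nat \<Rightarrow> mpol" where
  "step_label u v =
     (if v < u then var_y else if v = Suc u then (if u = 0 then var_b else var_z) else var_x)"

definition gap_label :: "nat \<Rightarrow> nat \<Rightarrow> nat \<Rightarrow> mpol" where
  "gap_label n u v = (if u = n then var_a else step_label u v)"

definition gap_weight :: "nat \<Rightarrow> (nat \<Rightarrow> nat) \<Rightarrow> mpol" where
  "gap_weight n s = (\<Prod>k\<le>n. gap_label n (s k) (next_letter n s k))"

text \<open>The letter \<open>Suc n\<close> splits gap \<open>i\<close> in two: the step up to it
  and the gap after it, labelled a. All other gaps keep both neighbours; their left letters are at
  most \<open>n\<close>, hence below the new maximum, so they carry plain step labels.\<close>

lemma gap_weight_insertion_cycle: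
  assumes s: "s permutes {1..n}" and i: "i \<le> n"
  shows "gap_weight (Suc n) (s \<circ> insertion_cycle n i) =
    step_label (s i) (Suc n) * var_a *
      (\<Prod>k\<in>{..n} - {i}. step_label (s k) (next_letter n s k))"
proof -
  let ?t = "s \<circ> insertion_cycle n i"
  let ?f = "\<lambda>k. gap_label (Suc n) (?t k) (next_letter (Suc n) ?t k)"
  have top: "s (Suc n) = Suc n" using s by (auto intro: permutes_not_in)
  have le: "s k \<le> n" if "k \<le> n" for k
    using s that permutes_in_image[OF s, of k] permutes_not_in[OF s, of k] by fastforce
  have "{..Suc n} = insert i (insert (Suc i) ({..Suc n} - {i, Suc i}))"
    using i by auto
  then have "gap_weight (Suc n) ?t = ?f i * (?f (Suc i) * prod ?f ({..Suc n} - {i, Suc i}))"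
    unfolding gap_weight_def by (metis (no_types, lifting) prod.insert Diff_iff finite_Diff
        finite_atMost finite_insert insertCI insertE n_not_Suc_n)
  also have "?f i = step_label (s i) (Suc n)"
    using i le[OF i] top by (simp add: gap_label_def next_letter_def insertion_cycle_def)
  also have "?f (Suc i) = var_a"
    using top by (simp add: gap_label_def insertion_cycle_def)
  also have "prod ?f ({..Suc n} - {i, Suc i}) =
      (\<Prod>k\<in>{..n} - {i}. step_label (s k) (next_letter n s k))"
  \<comment> \<open>Gaps to the left of gap \<open>i\<close> keep their index; those to the right
    move up by one place.\<close>
  proof (rule prod.reindex_bij_witness[where
        i = "\<lambda>k. if k < i then k else Suc k" and j = "\<lambda>k. if k < i then k else k - 1"])
    fix k assume k: "k \<in> {..Suc n} - {i, Suc i}"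
    show "step_label (s (if k < i then k else k - 1)) (next_letter n s (if k < i then k else k - 1))
        = ?f k"
    proof (cases "k < i")
      case True
      then show ?thesis
        using k i le[of k] by (auto simp: gap_label_def next_letter_def insertion_cycle_def)
    next
      case False
      then obtain l where "k = Suc l" "i < l" "l \<le> n" using k by (cases k) auto
      then show ?thesis
        using le[of l]
        by (auto simp: gap_label_def next_letter_def insertion_cycle_def)
    qed
  qed (use i in auto)
  finally show ?thesis by (simp only: mult.assoc)
qed

lemma step_label_top: "u < n \<Longrightarrow> step_label u (Suc n) = var_x"
  by (simp add: step_label_def)

text \<open>This makes the gap after \<open>n\<close> a descent, so its label becomes y once
  \<open>n\<close> is no longer the largest letter. At the last place the next letter is the closing
  0, which is below \<open>n\<close> because \<open>n\<close> is positive.\<close>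

lemma next_letter_less_top:
  assumes s: "s permutes {1..n}" and n: "n \<ge> 1" and "k \<le> n" "s k = n"
  shows "next_letter n s k < n"
proof (cases "k = n")
  case False
  then have "s (Suc k) \<in> {1..n}" using assms permutes_in_image[OF s, of "Suc k"] by auto
  moreover have "s (Suc k) \<noteq> s k" using permutes_inj[OF s] by (simp add: inj_eq)
  ultimately show ?thesis using False assms by (auto simp: next_letter_def)
qed (use n in \<open>simp add: next_letter_def\<close>)

section \<open>The derivation as the sum over all insertions\<close>

locale gap_derivation =
  fixes D :: "mpol \<Rightarrow> mpol"
  assumes derivation: "is_derivation D"
    and D_a: "D var_a = var_a * var_z"
    and D_b: "D var_b = var_x * var_y"
    and D_x: "D var_x = var_x * var_y"
    and D_y: "D var_y = var_x * var_y"
    and D_z: "D var_z = var_x * var_y"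
begin

text \<open>All labels but a have the same derivative, so inserting into such a gap has the same
  effect whatever its kind.\<close>

lemma D_step_label: "D (step_label u v) = var_x * var_y"
  by (simp add: step_label_def D_b D_x D_y D_z)

text \<open>If gap \<open>i\<close> follows the letter \<open>n\<close>, then a becomes a z: the
  succession n, n + 1 and the new gap after n + 1. Otherwise its label becomes x y: x is the jump up
  to n + 1, y is the new label of the gap after \<open>n\<close>, and the old factor a passes to the
  gap after n + 1.\<close>

lemma D_gap_label_prod:
  assumes s: "s permutes {1..n}" and n: "n \<ge> 1" and i: "i \<le> n"
  shows "D (gap_label n (s i) (next_letter n s i)) *
      (\<Prod>k\<in>{..n} - {i}. gap_label n (s k) (next_letter n s k)) =
    gap_weight (Suc n) (s \<circ> insertion_cycle n i)"
proof -
  let ?g = "\<lambda>k. gap_label n (s k) (next_letter n s k)"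
  let ?h = "\<lambda>k. step_label (s k) (next_letter n s k)"
  obtain j where j: "s j = n" using permutes_surj[OF s] by (metis surjD)
  have jn: "j \<le> n" using j n permutes_in_image[OF s, of j] by auto
  have uniq: "k = j" if "s k = n" for k
    using permutes_inj[OF s] j that by (metis injD)
  have gh: "?g k = ?h k" if "k \<noteq> j" for k
    using uniq that by (auto simp: gap_label_def)
  show ?thesis
  proof (cases "i = j")
    case True
    have "prod ?g ({..n} - {i}) = prod ?h ({..n} - {i})"
      using gh True by (intro prod.cong) auto
    \<comment> \<open>The pair n, n + 1 is labelled z and not b because \<open>n\<close> is
      positive.\<close>
    moreover have "step_label (s i) (Suc n) = var_z"
      using j n True by (simp add: step_label_def)
    ultimately show ?thesis
      using j True unfolding gap_weight_insertion_cycle[OF s i]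
      by (simp add: gap_label_def D_a mult_ac)
  next
    case False
    have split: "prod f ({..n} - {i}) = f j * prod f ({..n} - {i} - {j})" for f :: "nat \<Rightarrow> mpol"
      using jn False by (intro prod.remove) auto
    have "prod ?g ({..n} - {i} - {j}) = prod ?h ({..n} - {i} - {j})"
      using gh by (intro prod.cong) auto
    moreover have "?h j = var_y"
      using next_letter_less_top[OF s n jn j] j by (simp add: step_label_def)
    moreover have "s i \<le> n"
      using i permutes_in_image[OF s, of i] permutes_not_in[OF s, of i] by fastforce
    then have "step_label (s i) (Suc n) = var_x"
      using uniq False by (intro step_label_top) (auto simp: le_less)
    ultimately show ?thesis
      using j gh[OF False] unfolding gap_weight_insertion_cycle[OF s i] split
      by (simp add: D_step_label gap_label_def mult_ac)
  qed
qed

lemma D_gap_weight: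
  assumes "s permutes {1..n}" and "n \<ge> 1"
  shows "D (gap_weight n s) = (\<Sum>i\<le>n. gap_weight (Suc n) (s \<circ> insertion_cycle n i))"
  unfolding gap_weight_def[of n] derivation_prod[OF derivation finite_atMost]
  by (intro sum.cong refl D_gap_label_prod assms) simp

text \<open>The induction starts at the only permutation of [1]: its gap between 0 and 1 is labelled
  b, and the one after 1 is labelled a. In the step, every permutation of the next size arises from
  exactly one insertion.\<close>

lemma funpow_D_eq_sum_gap_weight:
  "(D ^^ n) (var_a * var_b) = (\<Sum>s | s permutes {1..Suc n}. gap_weight (Suc n) s)"
proof (induction n)
  case 0
  show ?case
    by (simp add: gap_weight_def gap_label_def step_label_def next_letter_def mult_ac)
next
  case (Suc n)
  let ?S = "{s. s permutes {1..Suc n}}"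
  have "(D ^^ Suc n) (var_a * var_b) = (\<Sum>s\<in>?S. D (gap_weight (Suc n) s))"
    by (simp add: Suc.IH derivation_sum[OF derivation])
  also have "\<dots> =
      (\<Sum>s\<in>?S. \<Sum>i\<le>Suc n. gap_weight (Suc (Suc n)) (s \<circ> insertion_cycle (Suc n) i))"
    by (intro sum.cong refl D_gap_weight) auto
  also have "\<dots> = (\<Sum>s | s permutes {1..Suc (Suc n)}. gap_weight (Suc (Suc n)) s)"
    unfolding sum.cartesian_product
    by (subst sum.reindex_bij_betw[OF bij_betw_insertion, symmetric])
      (simp add: case_prod_beta)
  finally show ?case .
qed

end

section \<open>Recovering the statistics\<close>

(* The gap after the letter n and the closing gap are both descents, so labelling only the former
   by a leaves as many y as there are interior descents. *)
lemma gap_weight_eq_prod_step_label: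
  assumes s: "s permutes {1..n}" and n: "n \<ge> 1"
  shows "gap_weight n s = var_a * (\<Prod>k<n. step_label (s k) (s (Suc k)))"
proof -
  let ?g = "\<lambda>k. gap_label n (s k) (next_letter n s k)"
  let ?h = "\<lambda>k. step_label (s k) (next_letter n s k)"
  obtain j where j: "s j = n" using permutes_surj[OF s] by (metis surjD)
  have jn: "j \<le> n" using j n permutes_in_image[OF s, of j] by auto
  have uniq: "k = j" if "s k = n" for k
    using permutes_inj[OF s] j that by (metis injD)
  have "gap_weight n s = ?g j * prod ?g ({..n} - {j})"
    unfolding gap_weight_def using jn by (intro prod.remove) auto
  also have "prod ?g ({..n} - {j}) = prod ?h ({..n} - {j})"
    using uniq by (intro prod.cong) (auto simp: gap_label_def)
  also have "\<dots> = prod ?h ({..n} - {n})"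
  proof (cases "j = n")
    case False
    have "s n \<in> {1..n}" using n permutes_in_image[OF s, of n] by auto
    then have "?h n = var_y"
      by (simp add: step_label_def next_letter_def)
    moreover have "?h j = var_y"
      using next_letter_less_top[OF s n jn j] j by (simp add: step_label_def)
    moreover have "prod ?h ({..n} - {j}) = ?h n * prod ?h ({..n} - {j} - {n})"
      using False by (intro prod.remove) auto
    moreover have "prod ?h ({..n} - {n}) = ?h j * prod ?h ({..n} - {n} - {j})"
      using False jn by (intro prod.remove) auto
    moreover have "{..n} - {j} - {n} = {..n} - {n} - {j}" by auto
    ultimately show ?thesis by simp
  qed simp
  also have "\<dots> = (\<Prod>k<n. step_label (s k) (s (Suc k)))"
    by (intro prod.cong) (auto simp: next_letter_def)
  finally show ?thesis using j by (simp add: gap_label_def)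
qed

lemma prod_if_const:
  fixes c :: "'a :: comm_monoid_mult"
  assumes "finite A"
  shows "(\<Prod>k\<in>A. if P k then c else 1) = c ^ card {k \<in> A. P k}"
  using prod.inter_filter[OF assms, of "\<lambda>_. c" P] by simp

text \<open>The substitution removes the a left over from the gap after \<open>n\<close>, and the b
  of an initial step from 0 to 1. Each remaining gap contributes one factor, so the product splits
  into a power for each statistic.\<close>

lemma at_a1_b1_gap_weight:
  assumes s: "s permutes {1..n}" and n: "n \<ge> 1"
  shows "at_a1_b1 (gap_weight n s) = var_x ^ jump n s * var_y ^ des n s * var_z ^ suc n s"
proof -
  have s0: "s 0 = 0" using s by (auto intro: permutes_not_in)
  have zero_iff: "s k = 0 \<longleftrightarrow> k = 0" for k
    using s0 permutes_inj[OF s] by (metis injD)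
  \<comment> \<open>The condition \<open>k \<ge> 1\<close> separates interior successions from the
    step 0, 1, whose label b becomes 1.\<close>
  have step: "at_a1_b1 (step_label (s k) (s (Suc k))) =
      (if s (Suc k) \<ge> s k + 2 then var_x else 1) * (if s k > s (Suc k) then var_y else 1) *
        (if k \<ge> 1 \<and> s k + 1 = s (Suc k) then var_z else 1)" for k
  proof -
    \<comment> \<open>Rules out equal neighbours, which \<open>step_label\<close> would label x
      although they form no jump.\<close>
    have "s (Suc k) \<noteq> s k" using permutes_inj[OF s] by (simp add: inj_eq)
    then show ?thesis
      using zero_iff[of k] by (auto simp: step_label_def at_a1_b1_def mpol_subst_var)
  qed
  \<comment> \<open>Gap \<open>k\<close> is indexed by the place it leaves, whereas
    \<open>jump\<close> counts by the place reached.\<close>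
  have "{i. 1 \<le> i \<and> i \<le> n \<and> s i \<ge> s (i - 1) + 2} = Suc ` {k \<in> {..<n}. s (Suc k) \<ge> s k + 2}"
  proof (intro equalityI subsetI)
    fix i assume "i \<in> {i. 1 \<le> i \<and> i \<le> n \<and> s i \<ge> s (i - 1) + 2}"
    then show "i \<in> Suc ` {k \<in> {..<n}. s (Suc k) \<ge> s k + 2}"
      by (intro image_eqI[of _ _ "i - 1"]) auto
  qed auto
  then have jump: "card {k \<in> {..<n}. s (Suc k) \<ge> s k + 2} = jump n s"
    by (simp add: jump_def card_image)
  \<comment> \<open>No descent occurs at \<open>k = 0\<close> because \<open>s 0 = 0\<close>, so
    both index ranges give the same set.\<close>
  have "{k \<in> {..<n}. s k > s (Suc k)} = {i. 1 \<le> i \<and> i \<le> n - 1 \<and> s i > s (i + 1)}"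
    using s0 n by (auto simp: Suc_le_eq intro: gr0I)
  then have des: "card {k \<in> {..<n}. s k > s (Suc k)} = des n s"
    by (simp only: des_def)
  have "{k \<in> {..<n}. k \<ge> 1 \<and> s k + 1 = s (Suc k)} =
      {i. 1 \<le> i \<and> i \<le> n - 1 \<and> s i + 1 = s (i + 1)}"
    using n by auto
  then have suc: "card {k \<in> {..<n}. k \<ge> 1 \<and> s k + 1 = s (Suc k)} = suc n s"
    by (simp only: suc_def)
  have "at_a1_b1 (gap_weight n s) = (\<Prod>k<n. at_a1_b1 (step_label (s k) (s (Suc k))))"
    unfolding gap_weight_eq_prod_step_label[OF s n]
    by (simp add: at_a1_b1_def mpol_subst_mult mpol_subst_prod mpol_subst_var)
  also have "\<dots> = var_x ^ jump n s * var_y ^ des n s * var_z ^ suc n s"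
    unfolding step prod.distrib prod_if_const[OF finite_lessThan] jump des suc ..
  finally show ?thesis .
qed

theorem theorem3p6:
  fixes D :: "mpol \<Rightarrow> mpol" and n :: nat
  assumes "is_derivation D"
    and "D var_a = var_a * var_z"
    and "D var_b = var_x * var_y"
    and "D var_x = var_x * var_y"
    and "D var_y = var_x * var_y"
    and "D var_z = var_x * var_y"
    and "n \<ge> 1"
  shows "R n = at_a1_b1 ((D ^^ (n - 1)) (var_a * var_b))"
proof -
  interpret gap_derivation D
    by unfold_locales (fact assms)+
  have "(D ^^ (n - 1)) (var_a * var_b) = (\<Sum>s | s permutes {1..n}. gap_weight n s)"
    using funpow_D_eq_sum_gap_weight[of "n - 1"] \<open>n \<ge> 1\<close> by simp
  then have "at_a1_b1 ((D ^^ (n - 1)) (var_a * var_b)) =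
      (\<Sum>s | s permutes {1..n}. at_a1_b1 (gap_weight n s))"
    by (simp add: at_a1_b1_def mpol_subst_sum)
  also have "\<dots> = R n"
    unfolding R_def using \<open>n \<ge> 1\<close> by (intro sum.cong) (auto simp: at_a1_b1_gap_weight)
  finally show ?thesis by simp
qed

end
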